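(* Let $a<b<c$ be in $\mathbb{N}$. Then the set $\mathsf{PA}^{\mathrm{inv},\uparrow}_3(\mathbf{y})$ is as follows: \begin{itemize} \item $\mathbf{y}=(a,a,a)$: $\{(1,1,1),(1,1,1+a),(1,1,1+2a),(1,1+a,1+a),(1,1+a,1+2a)\}$. \item $\mathbf{y}=(a,a,b)$: $\{(1,1,1),(1,1,1+a)\}$. \item $\mathbf{y}=(a,b,a)$ with $b=2a$: $\{(1,1,1),(1,1,1+a),(1,1,1+2a)\}$. \item $\mathbf{y}=(a,b,a)$ with $b\ne 2a$: $\{(1,1,1),(1,1,1+a)\}$. \item $\mathbf{y}=(b,a,a)$ with $2a\le b$: $\{(1,1,1),(1,1,1+a),(1,1,1+2a),(1,1+a,1+a),(1,1+a,1+2a)\}$. \item $\mathbf{y}=(b,a,a)$ with $2a>b$: $\{(1,1,1),(1,1,1+a),(1,1+a,1+a)\}$. \item $\mathbf{y}=(a,b,b)$: $\{(1,1,1)\}$. \item $\mathbf{y}=(b,a,b)$: $\{(1,1,1),(1,1,1+a)\}$. \item $\mathbf{y}=(b,b,a)$: $\{(1,1,1),(1,1,1+a),(1,1,1+b),(1,1,1+a+b)\}$. \item $\mathbf{y}=(a,b,c)$: $\{(1,1,1)\}$. \item $\mathbf{y}=(a,c,b)$ with $a+b=c$: $\{(1,1,1),(1,1,1+a+b)\}$. \item $\mathbf{y}=(a,c,b)$ with $a+b\ne c$: $\{(1,1,1)\}$. \item $\mathbf{y}=(b,a,c)$: $\{(1,1,1),(1,1,1+a)\}$. \item $\mathbf{y}=(b,c,a)$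 with $a+b=c$: $\{(1,1,1),(1,1,1+a),(1,1,1+a+b)\}$. \item $\mathbf{y}=(b,c,a)$ with $a+b\ne c$: $\{(1,1,1),(1,1,1+a)\}$. \item $\mathbf{y}=(c,a,b)$ with $a+b\le c$: $\{(1,1,1),(1,1,1+a),(1,1,1+a+b)\}$. \item $\mathbf{y}=(c,a,b)$ with $a+b>c$: $\{(1,1,1),(1,1,1+a)\}$. \item $\mathbf{y}=(c,b,a)$ with $a+b\le c$: $\{(1,1,1),(1,1,1+a),(1,1,1+b),(1,1,1+a+b)\}$. \item $\mathbf{y}=(c,b,a)$ with $a+b>c$: $\{(1,1,1),(1,1,1+a),(1,1,1+b)\}$. \end{itemize}
   Context: $\mathbb{N}=\{1,2,3,\ldots\}$ and $[k]=\{1,\ldots,k\}$. Let $\mathbf{y}=(y_1,\ldots,y_n)\in\mathbb{N}^n$ be car lengths and $m=\sum_{i=1}^n y_i$. A one-way street has spots $1,\ldots,m$, initially empty. Given preferences $\mathbf{x}=(x_1,\ldots,x_n)\in[m]^n$, cars $1,\ldots,n$ enter in this order; car $i$ parks in spots $j,j+1,\ldots,j+y_i-1$, where $j\ge x_i$ is the smallest integer such that $j+y_i-1\le m$ and all these spots are unoccupied; if no such $j$ exists, parking fails. If all cars park, $\mathbf{x}$ is a parking assortment for $\mathbf{y}$; $\mathsf{PA}_n(\mathbf{y})$ is the set of these. $\mathsf{PA}^{\mathrm{inv}}_n(\mathbf{y})$ is the set of (permutation) invariant parking assortments: those $\mathbf{x}\in\mathsf{PA}_n(\mathbf{y})$ all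 of whose rearrangements are also in $\mathsf{PA}_n(\mathbf{y})$ (with $\mathbf{y}$ fixed). $\mathsf{PA}^{\mathrm{inv},\uparrow}_n(\mathbf{y})=\{\mathbf{x}\in\mathsf{PA}^{\mathrm{inv}}_n(\mathbf{y}): x_1\le x_2\le\cdots\le x_n\}$. *)

theory Defs
  imports "HOL-Library.Multiset"
begin

text \<open>Car lengths \<open>ys\<close> and preferences \<open>xs\<close> are lists whose \<open>i\<close>-th entry belongs to the \<open>i\<close>-th
  car. Entries of both are meant to be positive, so truncated subtraction in \<open>j + y - 1\<close> is
  harmless: positivity of preferences is part of the definition of \<open>PA\<close>, while positivity of the
  lengths is left to the theorems.\<close>

definition can_park :: "nat \<Rightarrow> nat set \<Rightarrow> nat \<Rightarrow> nat \<Rightarrow> nat \<Rightarrow> bool" where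
  "can_park m occupied y x j \<longleftrightarrow>
     x \<le> j \<and> j + y - 1 \<le> m \<and> {j..j + y - 1} \<inter> occupied = {}"

fun all_park :: "nat \<Rightarrow> nat set \<Rightarrow> nat list \<Rightarrow> nat list \<Rightarrow> bool" where
  "all_park m occupied [] [] \<longleftrightarrow> True"
| "all_park m occupied (y # ys) (x # xs) \<longleftrightarrow>
     (\<exists>j. can_park m occupied y x j) \<and>
     (let j = (LEAST j. can_park m occupied y x j)
      in all_park m (occupied \<union> {j..j + y - 1}) ys xs)"
| "all_park m occupied _ _ \<longleftrightarrow> False"

definition PA :: "nat list \<Rightarrow> nat list set" where
  "PA ys = {xs. length xs = length ys \<and> set xs \<subseteq> {1..sum_list ys} \<and>
                all_park (sum_list ys) {} ys xs}"

definition PA_inv :: "nat list \<Rightarrow> nat list set" where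
  "PA_inv ys = {xs \<in> PA ys. \<forall>xs'. mset xs' = mset xs \<longrightarrow> xs' \<in> PA ys}"

definition PA_inv_up :: "nat list \<Rightarrow> nat list set" where
  "PA_inv_up ys = {xs \<in> PA_inv ys. sorted xs}"

end

theory Submission
  imports Defs
begin

text \<open>Since the lengths add up to the length of the street, the last of three cars has to fill a gap
  of exactly its own size. So the first two cars occupy one of six configurations, which
  describes \<open>PA\<close> by linear constraints. One entry of a parking assortment is then \<open>1\<close>, and letting
  the other two entries lead in all possible orders leaves, for arbitrary lengths, at most six
  invariant candidates, each with a linear condition on the lengths.\<close>

section \<open>First-fit parking with at most one car already on the street\<close>

text \<open>Trades \<open>LEAST\<close> and \<open>let\<close> for a witness with explicit
  minimality. In this form the continuation of the process can be abstracted as a predicate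
  \<open>P\<close> of the spot taken.\<close>

lemma all_park_Cons_iff:
  "all_park m occ (y # ys) (x # xs) \<longleftrightarrow>
     (\<exists>j. can_park m occ y x j \<and> (\<forall>i<j. \<not> can_park m occ y x i) \<and>
          all_park m (occ \<union> {j..j + y - 1}) ys xs)" (is "?L \<longleftrightarrow> ?R")
proof
  assume ?L
  then have "\<exists>j. can_park m occ y x j"
    and "all_park m (occ \<union> {(LEAST j. can_park m occ y x j)..(LEAST j. can_park m occ y x j) + y - 1}) ys xs"
    by (simp_all add: Let_def)
  then show ?R
    by (intro exI[of _ "LEAST j. can_park m occ y x j"]) (auto intro: LeastI_ex dest: not_less_Least)
next
  assume ?R
  then obtain j where j: "can_park m occ y x j" "\<forall>i<j. \<not> can_park m occ y x i"
    "all_park m (occ \<union> {j..j + y - 1}) ys xs" by blast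
  then have "(LEAST j. can_park m occ y x j) = j"
    by (intro Least_equality) (auto simp: not_less[symmetric])
  with j show ?L by (auto simp: Let_def)
qed

text \<open>Positive lengths exclude empty blocks, which would be disjoint from everything, and make
  the truncated subtraction exact; what remains is linear arithmetic.\<close>

lemma atLeastAtMost_disjoint_iff:
  fixes j p y z :: nat
  assumes "1 \<le> y" "1 \<le> z"
  shows "{j..j + y - 1} \<inter> {p..p + z - 1} = {} \<longleftrightarrow> j + y \<le> p \<or> p + z \<le> j"
  using assms by (auto simp: Int_atLeastAtMost)

lemma can_park_empty_iff:
  assumes "1 \<le> y"
  shows "can_park m {} y x j \<longleftrightarrow> x \<le> j \<and> j + y \<le> m + 1"
  using assms by (auto simp: can_park_def)

lemma can_park_one_iff:
  assumes "1 \<le> y" "1 \<le> z"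
  shows "can_park m {p..p + z - 1} y x j \<longleftrightarrow>
    x \<le> j \<and> j + y \<le> m + 1 \<and> (j + y \<le> p \<or> p + z \<le> j)"
  unfolding can_park_def atLeastAtMost_disjoint_iff[OF assms] using assms by auto

lemma can_park_two_iff:
  assumes "1 \<le> y" "1 \<le> z" "1 \<le> w"
  shows "can_park m ({p..p + z - 1} \<union> {q..q + w - 1}) y x j \<longleftrightarrow>
    x \<le> j \<and> j + y \<le> m + 1 \<and> (j + y \<le> p \<or> p + z \<le> j) \<and> (j + y \<le> q \<or> q + w \<le> j)"
  unfolding can_park_def Int_Un_distrib Un_empty
    atLeastAtMost_disjoint_iff[OF assms(1,2)] atLeastAtMost_disjoint_iff[OF assms(1,3)]
  using assms by auto

text \<open>On an empty street only the right end restricts the car, so if any spot is feasible then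
  the preferred one is, and it comes first. \<open>P\<close> stands for the parking of the remaining
  cars.\<close>

lemma first_fit_empty_iff:
  assumes "1 \<le> y"
  shows "(\<exists>j. can_park m {} y x j \<and> (\<forall>i<j. \<not> can_park m {} y x i) \<and> P j) \<longleftrightarrow>
    x + y \<le> m + 1 \<and> P x" (is "?L \<longleftrightarrow> ?R")
proof
  assume ?L
  then obtain j where j: "x \<le> j" "j + y \<le> m + 1" "P j"
    and first: "\<And>i. i < j \<Longrightarrow> \<not> (x \<le> i \<and> i + y \<le> m + 1)"
    by (auto simp: can_park_empty_iff[OF assms])
  have "j = x" using j first[of x] by linarith
  with j show ?R by simp
next
  assume ?R
  then show ?L by (intro exI[of _ x]) (auto simp: can_park_empty_iff[OF assms])
qed

text \<open>A car whose preferred position meets the parked block can only move right, and every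
  start before \<open>p + z\<close> still overlaps the block, so it stops directly behind it. At
  \<open>x = p + z\<close> both disjuncts apply and agree; the weak bound lets later case
  distinctions treat this spot together with the pushed cars.\<close>

lemma first_fit_one_iff:
  assumes "1 \<le> y" "1 \<le> z"
  shows "(\<exists>j. can_park m {p..p + z - 1} y x j \<and> (\<forall>i<j. \<not> can_park m {p..p + z - 1} y x i) \<and> P j) \<longleftrightarrow>
    (x + y \<le> p \<or> p + z \<le> x) \<and> x + y \<le> m + 1 \<and> P x \<or>
    p < x + y \<and> x \<le> p + z \<and> p + z + y \<le> m + 1 \<and> P (p + z)" (is "?L \<longleftrightarrow> ?R")
proof
  assume ?L
  then obtain j where j: "x \<le> j" "j + y \<le> m + 1" "j + y \<le> p \<or> p + z \<le> j" "P j"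
    and first: "\<And>i. i < j \<Longrightarrow> \<not> (x \<le> i \<and> i + y \<le> m + 1 \<and> (i + y \<le> p \<or> p + z \<le> i))"
    unfolding can_park_one_iff[OF assms] by blast
  show ?R
  proof (cases "x + y \<le> p \<or> p + z \<le> x")
    case True
    then have "j = x" using j first[of x] by linarith
    with j True show ?thesis by simp
  next
    case False
    then have "j = p + z" using j first[of "p + z"] by linarith
    with j False show ?thesis by simp
  qed
next
  assume ?R
  then show ?L
  proof
    assume "(x + y \<le> p \<or> p + z \<le> x) \<and> x + y \<le> m + 1 \<and> P x"
    then show ?L
      unfolding can_park_one_iff[OF assms] by (intro exI[of _ x]) auto
  next
    assume "p < x + y \<and> x \<le> p + z \<and> p + z + y \<le> m + 1 \<and> P (p + z)"
    then show ?L
      unfolding can_park_one_iff[OF assms] by (intro exI[of _ "p + z"]) auto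
  qed
qed

section \<open>The last car and the description of \<open>PA\<close> for three cars\<close>

text \<open>The street has exactly the total length of the cars, so a third disjoint block leaves no
  spot empty. The six disjuncts are the six left-to-right orders of the cars; the bound on
  \<open>x\<close> is the start of the third car in that order.\<close>

lemma ex_last_spot_iff:
  fixes p q x y1 y2 y3 :: nat
  assumes "1 \<le> p" "1 \<le> q" "1 \<le> x"
    and "p + y1 \<le> y1 + y2 + y3 + 1" "q + y2 \<le> y1 + y2 + y3 + 1"
    and "1 \<le> y1" "1 \<le> y2" "1 \<le> y3"
    and "q + y2 \<le> p \<or> p + y1 \<le> q"
  shows "(\<exists>k. x \<le> k \<and> k + y3 \<le> y1 + y2 + y3 + 1 \<and> (k + y3 \<le> p \<or> p + y1 \<le> k) \<and> (k + y3 \<le> q \<or> q + y2 \<le> k)) \<longleftrightarrow>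
    (p = 1 \<and> q = 1 + y1 \<and> x \<le> 1 + y1 + y2) \<or>
    (p = 1 \<and> q = 1 + y1 + y3 \<and> x \<le> 1 + y1) \<or>
    (p = 1 + y2 \<and> q = 1 \<and> x \<le> 1 + y1 + y2) \<or>
    (p = 1 + y3 \<and> q = 1 + y1 + y3 \<and> x = 1) \<or>
    (p = 1 + y2 + y3 \<and> q = 1 \<and> x \<le> 1 + y2) \<or>
    (p = 1 + y2 + y3 \<and> q = 1 + y3 \<and> x = 1)" (is "?L \<longleftrightarrow> ?R")
proof
  assume ?L
  then obtain k where k: "x \<le> k" "k + y3 \<le> y1 + y2 + y3 + 1"
    "k + y3 \<le> p \<or> p + y1 \<le> k" "k + y3 \<le> q \<or> q + y2 \<le> k" by blast
  \<comment> \<open>Each pair of cars is ordered one way or the other, which gives eight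
    combinations. Six are linear orders and determine all three starts.\<close>
  have "p = 1 \<and> q = 1 + y1 \<and> x \<le> 1 + y1 + y2" if "p + y1 \<le> q" "p + y1 \<le> k" "q + y2 \<le> k"
    using that k(1,2) assms(1-8) by linarith
  moreover have "p = 1 \<and> q = 1 + y1 + y3 \<and> x \<le> 1 + y1" if "p + y1 \<le> q" "p + y1 \<le> k" "k + y3 \<le> q"
    using that k(1,2) assms(1-8) by linarith
  moreover have "p = 1 + y2 \<and> q = 1 \<and> x \<le> 1 + y1 + y2" if "q + y2 \<le> p" "p + y1 \<le> k" "q + y2 \<le> k"
    using that k(1,2) assms(1-8) by linarith
  moreover have "p = 1 + y3 \<and> q = 1 + y1 + y3 \<and> x = 1" if "p + y1 \<le> q" "k + y3 \<le> p" "k + y3 \<le> q"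
    using that k(1,2) assms(1-8) by linarith
  moreover have "p = 1 + y2 + y3 \<and> q = 1 \<and> x \<le> 1 + y2" if "q + y2 \<le> p" "k + y3 \<le> p" "q + y2 \<le> k"
    using that k(1,2) assms(1-8) by linarith
  moreover have "p = 1 + y2 + y3 \<and> q = 1 + y3 \<and> x = 1" if "q + y2 \<le> p" "k + y3 \<le> p" "k + y3 \<le> q"
    using that k(1,2) assms(1-8) by linarith
  \<comment> \<open>The other two combinations are cyclic, hence impossible for positive
    lengths.\<close>
  moreover have "\<not> (p + y1 \<le> q \<and> k + y3 \<le> p \<and> q + y2 \<le> k)" "\<not> (q + y2 \<le> p \<and> p + y1 \<le> k \<and> k + y3 \<le> q)"
    using assms(6-8) by linarith+
  ultimately show ?R using assms(9) k(3,4) by metis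
next
  assume ?R
  then consider (k1) "p = 1" "q = 1 + y1" "x \<le> 1 + y1 + y2"
    | (k2) "p = 1" "q = 1 + y1 + y3" "x \<le> 1 + y1"
    | (k3) "p = 1 + y2" "q = 1" "x \<le> 1 + y1 + y2"
    | (k4) "p = 1 + y3" "q = 1 + y1 + y3" "x = 1"
    | (k5) "p = 1 + y2 + y3" "q = 1" "x \<le> 1 + y2"
    | (k6) "p = 1 + y2 + y3" "q = 1 + y3" "x = 1" by blast
  then show ?L
  \<comment> \<open>The witness is one plus the total length of the cars standing to the left of the
    third.\<close>
  proof cases
    case k1 then show ?thesis by (intro exI[of _ "1 + y1 + y2"]) auto
  next
    case k2 then show ?thesis by (intro exI[of _ "1 + y1"]) auto
  next
    case k3 then show ?thesis by (intro exI[of _ "1 + y1 + y2"]) auto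
  next
    case k4 then show ?thesis by (intro exI[of _ 1]) auto
  next
    case k5 then show ?thesis by (intro exI[of _ "1 + y2"]) auto
  next
    case k6 then show ?thesis by (intro exI[of _ 1]) auto
  qed
qed

text \<open>The first car takes its preferred spot. The second either keeps its own or is pushed to
  \<open>x1 + y1\<close>, and each order of the cars on the street then turns into conditions on the
  preferences. In the fourth disjunct, \<open>1 + y3 < x2 + y2\<close> says that the second car does
  not fit into the gap of length \<open>y3\<close> at the left end.\<close>

lemma PA_three_iff:
  assumes "1 \<le> y1" "1 \<le> y2" "1 \<le> y3"
  shows "[x1, x2, x3] \<in> PA [y1, y2, y3] \<longleftrightarrow> 1 \<le> x1 \<and> 1 \<le> x2 \<and> 1 \<le> x3 \<and>
    (x1 = 1 \<and> x2 \<le> 1 + y1 \<and> x3 \<le> 1 + y1 + y2 \<or>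
     x1 = 1 \<and> x2 = 1 + y1 + y3 \<and> x3 \<le> 1 + y1 \<or>
     x1 = 1 + y2 \<and> x2 = 1 \<and> x3 \<le> 1 + y1 + y2 \<or>
     x1 = 1 + y3 \<and> x2 \<le> 1 + y1 + y3 \<and> 1 + y3 < x2 + y2 \<and> x3 = 1 \<or>
     x1 = 1 + y2 + y3 \<and> x2 = 1 \<and> x3 \<le> 1 + y2 \<or>
     x1 = 1 + y2 + y3 \<and> x2 = 1 + y3 \<and> x3 = 1)" (is "_ \<longleftrightarrow> ?R")
proof -
  define m where "m = y1 + y2 + y3"
  \<comment> \<open>\<open>last q\<close> says that the third car finds a spot once the second one
    starts at \<open>q\<close>. No car follows, so which spot it takes does not matter.\<close>
  define last where "last q \<longleftrightarrow> (\<exists>k. x3 \<le> k \<and> k + y3 \<le> m + 1 \<and>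
    (k + y3 \<le> x1 \<or> x1 + y1 \<le> k) \<and> (k + y3 \<le> q \<or> q + y2 \<le> k))" for q
  have last_car: "all_park m ({x1..x1 + y1 - 1} \<union> {q..q + y2 - 1}) [y3] [x3] \<longleftrightarrow> last q" for q
    unfolding last_def can_park_two_iff[OF assms(3,1,2), symmetric] by simp
  have park: "all_park m {} [y1, y2, y3] [x1, x2, x3] \<longleftrightarrow> x1 + y1 \<le> m + 1 \<and>
    ((x2 + y2 \<le> x1 \<or> x1 + y1 \<le> x2) \<and> x2 + y2 \<le> m + 1 \<and> last x2 \<or>
     x1 < x2 + y2 \<and> x2 \<le> x1 + y1 \<and> x1 + y1 + y2 \<le> m + 1 \<and> last (x1 + y1))"
    unfolding all_park_Cons_iff[of _ _ y1] first_fit_empty_iff[OF assms(1)] Un_empty_left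
      all_park_Cons_iff[of _ _ y2] first_fit_one_iff[OF assms(2,1)] last_car ..
  have bounds: "[x1, x2, x3] \<in> PA [y1, y2, y3] \<longleftrightarrow>
    1 \<le> x1 \<and> 1 \<le> x2 \<and> 1 \<le> x3 \<and> x1 \<le> m \<and> x2 \<le> m \<and> x3 \<le> m \<and> all_park m {} [y1, y2, y3] [x1, x2, x3]"
    unfolding PA_def m_def by (auto simp: add.assoc)
  have last: "last q \<longleftrightarrow>
    (x1 = 1 \<and> q = 1 + y1 \<and> x3 \<le> 1 + y1 + y2) \<or>
    (x1 = 1 \<and> q = 1 + y1 + y3 \<and> x3 \<le> 1 + y1) \<or>
    (x1 = 1 + y2 \<and> q = 1 \<and> x3 \<le> 1 + y1 + y2) \<or>
    (x1 = 1 + y3 \<and> q = 1 + y1 + y3 \<and> x3 = 1) \<or>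
    (x1 = 1 + y2 + y3 \<and> q = 1 \<and> x3 \<le> 1 + y2) \<or>
    (x1 = 1 + y2 + y3 \<and> q = 1 + y3 \<and> x3 = 1)"
    if "1 \<le> x1" "1 \<le> q" "1 \<le> x3" "x1 + y1 \<le> m + 1" "q + y2 \<le> m + 1" "q + y2 \<le> x1 \<or> x1 + y1 \<le> q" for q
    unfolding last_def m_def
    by (rule ex_last_spot_iff) (use that assms in \<open>simp_all add: m_def\<close>)
  show ?thesis
  proof
    assume "[x1, x2, x3] \<in> PA [y1, y2, y3]"
    then have pos: "1 \<le> x1" "1 \<le> x2" "1 \<le> x3" and fit: "x1 + y1 \<le> m + 1"
      and "(x2 + y2 \<le> x1 \<or> x1 + y1 \<le> x2) \<and> x2 + y2 \<le> m + 1 \<and> last x2 \<or>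
        x1 < x2 + y2 \<and> x2 \<le> x1 + y1 \<and> x1 + y1 + y2 \<le> m + 1 \<and> last (x1 + y1)"
      unfolding bounds park by blast+
    \<comment> \<open>Either the second car parks at its preference, or it is pushed directly behind
      the first.\<close>
    then consider "x2 + y2 \<le> x1 \<or> x1 + y1 \<le> x2" "x2 + y2 \<le> m + 1" "last x2"
      | "x1 < x2 + y2" "x2 \<le> x1 + y1" "x1 + y1 + y2 \<le> m + 1" "last (x1 + y1)" by blast
    then show ?R
    proof cases
      case 1
      from last[THEN iffD1, OF pos fit 1(2,1,3)] show ?thesis
        by (elim disjE conjE) (use pos assms in simp_all)
    next
      case 2
      have "1 \<le> x1 + y1" using pos by simp
      from last[THEN iffD1, OF pos(1) this pos(3) fit 2(3) disjI2[OF order_refl] 2(4)] show ?thesis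
        by (elim disjE conjE) (use pos assms 2(1,2) in simp_all)
    qed
  next
    assume R: ?R
    then have pos: "1 \<le> x1" "1 \<le> x2" "1 \<le> x3" by blast+
    \<comment> \<open>In \<open>k1\<close> and \<open>k4\<close> the second car ends up directly
      behind the first, possibly by preference; in the other four cases it starts at
      \<open>x2\<close>.\<close>
    from R consider
        (k1) "x1 = 1" "x2 \<le> 1 + y1" "x3 \<le> 1 + y1 + y2"
      | (k2) "x1 = 1" "x2 = 1 + y1 + y3" "x3 \<le> 1 + y1"
      | (k3) "x1 = 1 + y2" "x2 = 1" "x3 \<le> 1 + y1 + y2"
      | (k4) "x1 = 1 + y3" "x2 \<le> 1 + y1 + y3" "1 + y3 < x2 + y2" "x3 = 1"
      | (k5) "x1 = 1 + y2 + y3" "x2 = 1" "x3 \<le> 1 + y2"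
      | (k6) "x1 = 1 + y2 + y3" "x2 = 1 + y3" "x3 = 1" by blast
    then show "[x1, x2, x3] \<in> PA [y1, y2, y3]"
    proof cases
      case k1
      then have "last (1 + y1)"
        by (intro last[THEN iffD2]) (use pos in \<open>simp_all add: m_def\<close>)
      then show ?thesis unfolding bounds park using pos assms k1 by (simp add: m_def)
    next
      case k2
      then have "last x2"
        by (intro last[THEN iffD2]) (use pos in \<open>simp_all add: m_def\<close>)
      then show ?thesis unfolding bounds park using pos assms k2 by (simp add: m_def)
    next
      case k3
      then have "last x2"
        by (intro last[THEN iffD2]) (use pos in \<open>simp_all add: m_def\<close>)
      then show ?thesis unfolding bounds park using pos assms k3 by (simp add: m_def)
    next
      case k4
      then have "last (x1 + y1)"
        by (intro last[THEN iffD2]) (use pos in \<open>simp_all add: m_def\<close>)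
      then show ?thesis unfolding bounds park using pos assms k4 by (simp add: m_def)
    next
      case k5
      then have "last x2"
        by (intro last[THEN iffD2]) (use pos in \<open>simp_all add: m_def\<close>)
      then show ?thesis unfolding bounds park using pos assms k5 by (simp add: m_def)
    next
      case k6
      then have "last x2"
        by (intro last[THEN iffD2]) (use pos in \<open>simp_all add: m_def\<close>)
      then show ?thesis unfolding bounds park using pos assms k6 by (simp add: m_def)
    qed
  qed
qed

section \<open>Rearrangements and invariance for three cars\<close>

lemma mset_eq_three_iff:
  "mset xs = {#p, q, r#} \<longleftrightarrow>
     xs \<in> {[p, q, r], [p, r, q], [q, p, r], [q, r, p], [r, p, q], [r, q, p]}" (is "?L \<longleftrightarrow> ?R")
proof
  assume L: ?L
  then have "size (mset xs) = 3" by simp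
  then obtain u v w where "xs = [u, v, w]"
    by (auto simp: numeral_3_eq_3 length_Suc_conv)
  with L show ?R by (auto simp: add_eq_conv_ex)
qed auto

lemma PA_inv_three_iff:
  "[p, q, r] \<in> PA_inv ys \<longleftrightarrow>
     {[p, q, r], [p, r, q], [q, p, r], [q, r, p], [r, p, q], [r, q, p]} \<subseteq> PA ys"
proof -
  have m: "mset xs = mset [p, q, r] \<longleftrightarrow>
     xs \<in> {[p, q, r], [p, r, q], [q, p, r], [q, r, p], [r, p, q], [r, q, p]}" for xs
    using mset_eq_three_iff[of xs p q r] by simp
  show ?thesis unfolding PA_inv_def mem_Collect_eq m by blast
qed

text \<open>Only the position of \<open>r\<close> varies among the rearrangements. Putting
  \<open>r\<close> first leaves four possible values; putting it second and third then bounds it in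
  terms of the lengths.\<close>

lemma PA_inv_one_one_iff:
  assumes "1 \<le> y1" "1 \<le> y2" "1 \<le> y3"
  shows "[1, 1, r] \<in> PA_inv [y1, y2, y3] \<longleftrightarrow>
     r = 1 \<or>
     r = 1 + y2 \<and> (y2 \<le> y1 \<or> y2 = y1 + y3) \<or>
     r = 1 + y3 \<and> y3 < y2 \<and> y3 \<le> y1 \<or>
     r = 1 + y2 + y3 \<and> (y2 + y3 \<le> y1 \<or> y2 = y1 \<and> y3 \<le> y1)"
proof -
  have "[1, 1, r] \<in> PA_inv [y1, y2, y3] \<longleftrightarrow>
    [1, 1, r] \<in> PA [y1, y2, y3] \<and> [1, r, 1] \<in> PA [y1, y2, y3] \<and> [r, 1, 1] \<in> PA [y1, y2, y3]"
    unfolding PA_inv_three_iff by blast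
  also have "[1, 1, r] \<in> PA [y1, y2, y3] \<longleftrightarrow> 1 \<le> r \<and> r \<le> 1 + y1 + y2"
    unfolding PA_three_iff[OF assms] using assms by auto
  also have "[1, r, 1] \<in> PA [y1, y2, y3] \<longleftrightarrow> 1 \<le> r \<and> (r \<le> 1 + y1 \<or> r = 1 + y1 + y3)"
    unfolding PA_three_iff[OF assms] using assms by auto
  also have "[r, 1, 1] \<in> PA [y1, y2, y3] \<longleftrightarrow>
    r = 1 \<or> r = 1 + y2 \<or> r = 1 + y3 \<and> y3 < y2 \<or> r = 1 + y2 + y3"
    unfolding PA_three_iff[OF assms] using assms by auto
  finally show ?thesis using assms by auto
qed

text \<open>With only one entry equal to 1, whichever larger entry leads must leave a gap at the
  left end that is filled exactly. Comparing the rearrangements forces the last two lengths to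
  agree.\<close>

lemma PA_inv_one_gt_iff:
  assumes "1 \<le> y1" "1 \<le> y2" "1 \<le> y3" and "1 < q" "q \<le> r"
  shows "[1, q, r] \<in> PA_inv [y1, y2, y3] \<longleftrightarrow>
     y2 = y3 \<and> y2 \<le> y1 \<and> q = 1 + y2 \<and> (r = 1 + y2 \<or> r = 1 + 2 * y2 \<and> (2 * y2 \<le> y1 \<or> y2 = y1))"
    (is "?L \<longleftrightarrow> ?R")
proof
  assume L: ?L
  then have *: "[1, q, r] \<in> PA [y1, y2, y3]" "[1, r, q] \<in> PA [y1, y2, y3]"
      "[q, 1, r] \<in> PA [y1, y2, y3]" "[q, r, 1] \<in> PA [y1, y2, y3]" "[r, q, 1] \<in> PA [y1, y2, y3]"
    by (simp_all add: PA_inv_three_iff)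
  \<comment> \<open>Here the only preference 1 belongs to the third car, so this car stands
    leftmost; \<open>q <= r\<close> excludes that the second car comes next.\<close>
  have q: "q = 1 + y3" using *(4) assms unfolding PA_three_iff[OF assms(1-3)] by auto
  \<comment> \<open>Now the second car prefers 1 and fills the gap in front of \<open>q\<close>,
    which has length \<open>y3\<close>.\<close>
  moreover have "y2 = y3" using *(3) assms q unfolding PA_three_iff[OF assms(1-3)] by auto
  moreover have "r = 1 + y3 \<or> r = 1 + y2 + y3"
    using *(5) assms q unfolding PA_three_iff[OF assms(1-3)] by auto
  moreover have "q \<le> 1 + y1"
    using *(1) assms q unfolding PA_three_iff[OF assms(1-3)] by auto
  moreover have "r \<le> 1 + y1 \<or> r = 1 + y1 + y3"
    using *(2) assms unfolding PA_three_iff[OF assms(1-3)] by auto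
  ultimately show ?R by auto
next
  assume ?R
  then show ?L
    unfolding PA_inv_three_iff insert_subset PA_three_iff[OF assms(1-3)] using assms by auto
qed

text \<open>A uniform criterion for all positive lengths, with no assumption on their order; every
  case of the classification is an instance.\<close>

lemma PA_inv_up_three_iff:
  assumes "1 \<le> y1" "1 \<le> y2" "1 \<le> y3"
  shows "xs \<in> PA_inv_up [y1, y2, y3] \<longleftrightarrow>
     xs = [1, 1, 1] \<or>
     xs = [1, 1, 1 + y2] \<and> (y2 \<le> y1 \<or> y2 = y1 + y3) \<or>
     xs = [1, 1, 1 + y3] \<and> y3 < y2 \<and> y3 \<le> y1 \<or>
     xs = [1, 1, 1 + y2 + y3] \<and> (y2 + y3 \<le> y1 \<or> y2 = y1 \<and> y3 \<le> y1) \<or>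
     xs = [1, 1 + y2, 1 + y2] \<and> y2 = y3 \<and> y2 \<le> y1 \<or>
     xs = [1, 1 + y2, 1 + 2 * y2] \<and> y2 = y3 \<and> (2 * y2 \<le> y1 \<or> y2 = y1)" (is "?L \<longleftrightarrow> ?R")
proof
  assume L: ?L
  then have inv: "xs \<in> PA_inv [y1, y2, y3]" and "sorted xs" "length xs = 3"
    by (auto simp: PA_inv_up_def PA_inv_def PA_def)
  then obtain p q r where xs: "xs = [p, q, r]" and "p \<le> q" "q \<le> r"
    by (auto simp: numeral_3_eq_3 length_Suc_conv)
  \<comment> \<open>Every disjunct of \<open>PA_three_iff\<close> contains a preference equal to 1,
    so the smallest entry is 1.\<close>
  have "p = 1" "1 \<le> q"
    using inv \<open>p \<le> q\<close> \<open>q \<le> r\<close> unfolding xs PA_inv_three_iff insert_subset PA_three_iff[OF assms] by auto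
  show ?R
  proof (cases "q = 1")
    case True
    then show ?thesis
      using inv PA_inv_one_one_iff[OF assms, of r] unfolding xs \<open>p = 1\<close> by auto
  next
    case False
    then show ?thesis
      using inv PA_inv_one_gt_iff[OF assms, of q r] \<open>1 \<le> q\<close> \<open>q \<le> r\<close> unfolding xs \<open>p = 1\<close> by auto
  qed
next
  assume ?R
  then show ?L
    unfolding PA_inv_up_def
    using assms PA_inv_one_one_iff[OF assms] PA_inv_one_gt_iff[OF assms]
    by (elim disjE) auto
qed

theorem theorem5p4:
  fixes a b c :: nat
  assumes "1 \<le> a" and "a < b" and "b < c"
  shows
    "(PA_inv_up [a, a, a] = {[1, 1, 1], [1, 1, 1 + a], [1, 1, 1 + 2*a], [1, 1 + a, 1 + a], [1, 1 + a, 1 + 2*a]}) \<and>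
     (PA_inv_up [a, a, b] = {[1, 1, 1], [1, 1, 1 + a]}) \<and>
     (b = 2*a \<longrightarrow> PA_inv_up [a, b, a] = {[1, 1, 1], [1, 1, 1 + a], [1, 1, 1 + 2*a]}) \<and>
     (b \<noteq> 2*a \<longrightarrow> PA_inv_up [a, b, a] = {[1, 1, 1], [1, 1, 1 + a]}) \<and>
     (2*a \<le> b \<longrightarrow> PA_inv_up [b, a, a] = {[1, 1, 1], [1, 1, 1 + a], [1, 1, 1 + 2*a], [1, 1 + a, 1 + a], [1, 1 + a, 1 + 2*a]}) \<and>
     (2*a > b \<longrightarrow> PA_inv_up [b, a, a] = {[1, 1, 1], [1, 1, 1 + a], [1, 1 + a, 1 + a]}) \<and>
     (PA_inv_up [a, b, b] = {[1, 1, 1]}) \<and>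
     (PA_inv_up [b, a, b] = {[1, 1, 1], [1, 1, 1 + a]}) \<and>
     (PA_inv_up [b, b, a] = {[1, 1, 1], [1, 1, 1 + a], [1, 1, 1 + b], [1, 1, 1 + a + b]}) \<and>
     (PA_inv_up [a, b, c] = {[1, 1, 1]}) \<and>
     (a + b = c \<longrightarrow> PA_inv_up [a, c, b] = {[1, 1, 1], [1, 1, 1 + a + b]}) \<and>
     (a + b \<noteq> c \<longrightarrow> PA_inv_up [a, c, b] = {[1, 1, 1]}) \<and>
     (PA_inv_up [b, a, c] = {[1, 1, 1], [1, 1, 1 + a]}) \<and>
     (a + b = c \<longrightarrow> PA_inv_up [b, c, a] = {[1, 1, 1], [1, 1, 1 + a], [1, 1, 1 + a + b]}) \<and>
     (a + b \<noteq> c \<longrightarrow> PA_inv_up [b, c, a] = {[1, 1, 1], [1, 1, 1 + a]}) \<and>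
     (a + b \<le> c \<longrightarrow> PA_inv_up [c, a, b] = {[1, 1, 1], [1, 1, 1 + a], [1, 1, 1 + a + b]}) \<and>
     (a + b > c \<longrightarrow> PA_inv_up [c, a, b] = {[1, 1, 1], [1, 1, 1 + a]}) \<and>
     (a + b \<le> c \<longrightarrow> PA_inv_up [c, b, a] = {[1, 1, 1], [1, 1, 1 + a], [1, 1, 1 + b], [1, 1, 1 + a + b]}) \<and>
     (a + b > c \<longrightarrow> PA_inv_up [c, b, a] = {[1, 1, 1], [1, 1, 1 + a], [1, 1, 1 + b]})"
proof -
  have pos: "1 \<le> a" "1 \<le> b" "1 \<le> c" using assms by auto
  note iff = PA_inv_up_three_iff
  show ?thesis
    \<comment> \<open>One instance for each of the thirteen length vectors. The order of
      \<open>a\<close>, \<open>b\<close>, \<open>c\<close> and the stated case conditions settle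
      which candidates survive.\<close>
    unfolding set_eq_iff iff[OF pos(1) pos(1) pos(1)] iff[OF pos(1) pos(1) pos(2)]
      iff[OF pos(1) pos(2) pos(1)] iff[OF pos(2) pos(1) pos(1)] iff[OF pos(1) pos(2) pos(2)]
      iff[OF pos(2) pos(1) pos(2)] iff[OF pos(2) pos(2) pos(1)] iff[OF pos(1) pos(2) pos(3)]
      iff[OF pos(1) pos(3) pos(2)] iff[OF pos(2) pos(1) pos(3)] iff[OF pos(2) pos(3) pos(1)]
      iff[OF pos(3) pos(1) pos(2)] iff[OF pos(3) pos(2) pos(1)]
    using assms by (intro conjI impI allI; auto)
qed

end
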